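(* Let $n,k$ be positive integers with $k\le n$. Let $$\alpha_k=\sqrt{\frac{(2k-1)!}{(k-1)!}}\;(k-1)^{\frac14(k^2-k)}$$ and $$\beta_k=\left(k+\frac{k}{H_k}-1\right)^{\frac12(H_k/k)}(k-1)^{\frac12(1-H_k/k)},$$ where $H_j=\sum_{i=1}^j 1/i$ is the $j$-th harmonic number. Then $M_R(n,k)\le\alpha_k\,\beta_k^{\,n}$.
   Context: $R(n,k)$ denotes the set of $n\times n$ matrices with entries in $\{0,1\}$ each of whose rows sums to $k$, and $M_R(n,k)=\max_{A\in R(n,k)}\det(A)$. The convention $0^0=1$ is used (relevant only when $k=1$). *)

theory Defs
  imports "HOL-Analysis.Harmonic_Numbers" "Jordan_Normal_Form.Determinant"
begin

definition row_regular_mats :: "nat \<Rightarrow> nat \<Rightarrow> real mat set" where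
  "row_regular_mats n k =
     {A \<in> carrier_mat n n. (\<forall>i<n. \<forall>j<n. A $$ (i, j) \<in> {0, 1}) \<and>
        (\<forall>i<n. (\<Sum>j<n. A $$ (i, j)) = real k)}"

lemma finite_row_regular_mats: "finite (row_regular_mats n k)"
proof -
  let ?I = "{..<n} \<times> {..<n}"
  have "row_regular_mats n k \<subseteq> (\<lambda>f. mat n n f) ` (?I \<rightarrow>\<^sub>E {0, 1})"
  proof
    fix A assume A: "A \<in> row_regular_mats n k"
    let ?f = "restrict (\<lambda>p. A $$ p) ?I"
    have "A = mat n n ?f"
      using A by (intro eq_matI) (auto simp: row_regular_mats_def)
    moreover have "?f \<in> ?I \<rightarrow>\<^sub>E {0, 1}"
      using A by (auto simp: row_regular_mats_def)
    ultimately show "A \<in> (\<lambda>f. mat n n f) ` (?I \<rightarrow>\<^sub>E {0, 1})" by blast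
  qed
  moreover have "finite (?I \<rightarrow>\<^sub>E {0, 1 :: real})"
    by (intro finite_PiE) auto
  ultimately show ?thesis by (meson finite_imageI finite_subset)
qed

lemma row_regular_mats_nonempty:
  assumes "k \<le> n"
  shows "row_regular_mats n k \<noteq> {}"
proof -
  have "(\<Sum>j<n. if j < k then 1 else 0 :: real) = real k"
  proof -
    have "{..<n} \<inter> {j. j < k} = {..<k}" using assms by auto
    then show ?thesis by (simp add: sum.If_cases)
  qed
  then have "mat n n (\<lambda>(i, j). if j < k then 1 else 0) \<in> row_regular_mats n k"
    by (auto simp: row_regular_mats_def)
  then show ?thesis by blast
qed

(* By the two lemmas above, the maximum is over a finite nonempty set when k \<le> n. *)
definition max_det_row_regular :: "nat \<Rightarrow> nat \<Rightarrow> real" where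
  "max_det_row_regular n k = Max (det ` row_regular_mats n k)"

(* Real power with 0 to the power 0 equal to 1, where powr yields 0. *)
definition rpow :: "real \<Rightarrow> real \<Rightarrow> real" where
  "rpow x a = (if x = 0 \<and> a = 0 then 1 else x powr a)"

definition alpha :: "nat \<Rightarrow> real" where
  "alpha k = sqrt (fact (2 * k - 1) / fact (k - 1)) *
     rpow (real k - 1) (1 / 4 * ((real k)\<^sup>2 - real k))"

definition beta :: "nat \<Rightarrow> real" where
  "beta k =
     rpow (real k + real k / harm k - 1) (1 / 2 * (harm k / real k)) *
     rpow (real k - 1) (1 / 2 * (1 - harm k / real k))"

end

theory Submission
  imports Defs "HOL-Library.Disjoint_Sets"
begin

text \<open>
  The squared determinant of \<open>A\<close> is the determinant of the Gram matrix \<open>A A\<^sup>T\<close> of the rows, whose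
  diagonal entries are all \<open>k\<close>. Hadamard's inequality gives only \<open>k\<^sup>n\<close>. It is improved by noting that
  the \<open>n k\<close> ones are spread over only \<open>n\<close> columns, so that many rows meet in a common column and are far from
  orthogonal.

  Suppose that \<open>m\<close> rows have a one in the same column. Their inner products are all at least 1, and
  their Gram determinant is at most that of \<open>(k - 1) I + J\<close>, which is \<open>(k - 1)\<^bsup>m-1\<^esup> (k - 1 + m)\<close>.
  For a partition of all rows into such groups the bounds multiply
  (\<open>det_sq_le_prod_group_bound\<close> with \<open>sum_squares_le_of_common_column\<close>). The block bound and the
  multiplicativity are obtained in one step, by comparing \<open>A A\<^sup>T\<close> with the block diagonal matrix \<open>Q\<close> of the blocks
  \<open>(k - 1) I + J\<close>: the trace of \<open>Q\<^bsup>-1\<^esup> A A\<^sup>T\<close> is at most \<open>n\<close>, so its determinant is at most 1.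

  The groups are found greedily (\<open>greedy_grouping\<close>). While more than \<open>(j - 1) n / k\<close> rows remain,
  averaging gives a column with at least \<open>j\<close> ones in the remaining rows. Hence at most
  \<open>n / (k j) + 1\<close> groups of size \<open>j\<close> are needed, for \<open>j = k, k - 1, \<dots>, 1\<close>. The product of the bounds for the
  additional single groups of each size is the square of \<open>alpha k\<close> (\<open>alpha_sq\<close>). The other
  \<open>n / k * (1 + 1/2 + \<dots> + 1/k)\<close> groups have average size \<open>k / harm k\<close>, and concavity of the logarithm
  turns their product into the square of \<open>beta k ^ n\<close> (\<open>prod_group_bound_le_beta\<close>).
\<close>

section \<open>Hadamard's inequality\<close>

definition dotp :: "nat \<Rightarrow> (nat \<Rightarrow> real) \<Rightarrow> (nat \<Rightarrow> real) \<Rightarrow> real" where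
  "dotp n u v = (\<Sum>j<n. u j * v j)"

text \<open>Gram-Schmidt orthogonalisation of the rows \<open>a 0, a 1, \<dots>\<close>, without normalisation. Rows may be
  dependent: if \<open>gso n a l\<close> vanishes, its coefficient is a division by zero, hence 0.\<close>

fun gso :: "nat \<Rightarrow> (nat \<Rightarrow> nat \<Rightarrow> real) \<Rightarrow> nat \<Rightarrow> nat \<Rightarrow> real" where
  "gso n a i = (\<lambda>j. a i j - (\<Sum>l<i. dotp n (a i) (gso n a l) / dotp n (gso n a l) (gso n a l) * gso n a l j))"

declare gso.simps [simp del]

lemma dotp_self_nonneg: "0 \<le> dotp n u u"
  unfolding dotp_def by (intro sum_nonneg) simp

lemma dotp_commute: "dotp n u v = dotp n v u"
  unfolding dotp_def by (simp add: mult.commute)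

lemma dotp_eq_0:
  assumes "dotp n v v = 0"
  shows "dotp n u v = 0"
proof -
  have "\<forall>j<n. v j * v j = 0"
    using assms unfolding dotp_def by (subst (asm) sum_nonneg_eq_0_iff) auto
  then show ?thesis unfolding dotp_def by simp
qed

lemma dotp_diff_sum:
  "dotp n (\<lambda>j. u j - (\<Sum>l\<in>S. c l * w l j)) v = dotp n u v - (\<Sum>l\<in>S. c l * dotp n (w l) v)"
proof -
  have "(\<Sum>j<n. (\<Sum>l\<in>S. c l * w l j) * v j) = (\<Sum>l\<in>S. c l * (\<Sum>j<n. w l j * v j))"
    unfolding sum_distrib_left sum_distrib_right
    by (subst sum.swap) (simp add: mult.assoc)
  then show ?thesis
    unfolding dotp_def by (simp add: left_diff_distrib sum_subtractf)
qed

lemma gso_orthogonal_less: "m < i \<Longrightarrow> dotp n (gso n a i) (gso n a m) = 0"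
proof (induction i arbitrary: m rule: less_induct)
  case (less i)
  let ?w = "gso n a"
  let ?q = "\<lambda>l. dotp n (?w l) (?w l)"
  have orth: "dotp n (?w l) (?w m) = 0" if "l < i" "l \<noteq> m" for l
  proof (cases "l < m")
    case True
    then show ?thesis
      using less.IH[of m l] less.prems dotp_commute[of n "?w l" "?w m"] by simp
  next
    case False
    then show ?thesis using less.IH[of l m] that by simp
  qed
  have "dotp n (?w i) (?w m)
      = dotp n (a i) (?w m) - (\<Sum>l<i. dotp n (a i) (?w l) / ?q l * dotp n (?w l) (?w m))"
    by (subst gso.simps) (rule dotp_diff_sum)
  also have "(\<Sum>l<i. dotp n (a i) (?w l) / ?q l * dotp n (?w l) (?w m))
      = (\<Sum>l<i. if l = m then dotp n (a i) (?w m) / ?q m * ?q m else 0)"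
    using orth by (intro sum.cong) auto
  also have "\<dots> = dotp n (a i) (?w m)"
    using less.prems dotp_eq_0[of n "?w m"] by simp
  finally show ?case by simp
qed

lemma gso_orthogonal: "i \<noteq> m \<Longrightarrow> dotp n (gso n a i) (gso n a m) = 0"
  using gso_orthogonal_less[of i m] gso_orthogonal_less[of m i] dotp_commute
  by (metis nat_neq_iff)

text \<open>Pythagoras: \<open>a i\<close> is the sum of \<open>gso n a i\<close> and a vector orthogonal to it.\<close>

lemma dotp_gso_le: "dotp n (gso n a i) (gso n a i) \<le> dotp n (a i) (a i)"
proof -
  let ?w = "gso n a"
  let ?q = "\<lambda>l. dotp n (?w l) (?w l)"
  have expand: "dotp n (?w i) v
      = dotp n (a i) v - (\<Sum>l<i. dotp n (a i) (?w l) / ?q l * dotp n (?w l) v)" for v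
    by (subst gso.simps) (rule dotp_diff_sum)
  have "?q i = dotp n (a i) (?w i)"
    by (subst expand) (simp add: gso_orthogonal)
  also have "\<dots> = dotp n (?w i) (a i)" by (rule dotp_commute)
  also have "\<dots> = dotp n (a i) (a i) - (\<Sum>l<i. (dotp n (a i) (?w l))\<^sup>2 / ?q l)"
    by (subst expand) (simp add: dotp_commute[of n "gso n a _" "a i"] power2_eq_square)
  also have "\<dots> \<le> dotp n (a i) (a i)"
    using dotp_self_nonneg by (simp add: sum_nonneg)
  finally show ?thesis .
qed

text \<open>Gram-Schmidt factors \<open>A\<close> as \<open>M * W\<close> with \<open>M\<close> unit lower triangular and the rows of \<open>W\<close> orthogonal
  and no longer than those of \<open>A\<close>. Then \<open>W * W\<^sup>T\<close> is diagonal.\<close>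

theorem hadamard_inequality:
  fixes A :: "real mat"
  assumes A: "A \<in> carrier_mat n n"
  shows "(det A)\<^sup>2 \<le> (\<Prod>i<n. \<Sum>j<n. (A $$ (i, j))\<^sup>2)"
proof -
  define a where "a i j = A $$ (i, j)" for i j
  let ?w = "gso n a"
  define M where "M = mat n n (\<lambda>(i, l). if l < i then dotp n (a i) (?w l) / dotp n (?w l) (?w l)
                                          else if l = i then 1 else 0)"
  define W where "W = mat n n (\<lambda>(i, j). ?w i j)"
  have M: "M \<in> carrier_mat n n" and W: "W \<in> carrier_mat n n"
    unfolding M_def W_def by auto
  have "A = M * W"
  proof (rule eq_matI)
    fix i j assume "i < dim_row (M * W)" "j < dim_col (M * W)"
    then have i: "i < n" and j: "j < n" using M W by auto
    let ?c = "\<lambda>l. dotp n (a i) (?w l) / dotp n (?w l) (?w l)"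
    have "(M * W) $$ (i, j) = (\<Sum>l<n. M $$ (i, l) * W $$ (l, j))"
      using i j M W by (auto simp: times_mat_def scalar_prod_def atLeast0LessThan intro!: sum.cong)
    also have "\<dots> = (\<Sum>l<n. (if l < i then ?c l * ?w l j else if l = i then ?w i j else 0))"
      using i j by (intro sum.cong) (auto simp: M_def W_def)
    also have "\<dots> = (\<Sum>l\<in>insert i {..<i}. (if l < i then ?c l * ?w l j else if l = i then ?w i j else 0))"
      using i by (intro sum.mono_neutral_right) auto
    also have "\<dots> = ?w i j + (\<Sum>l<i. ?c l * ?w l j)"
      by (simp add: sum.insert)
    also have "\<dots> = a i j" by (subst (1) gso.simps) simp
    finally show "A $$ (i, j) = (M * W) $$ (i, j)" by (simp add: a_def)
  qed (use A M W in auto)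
  moreover have "det M = 1"
  proof -
    have "det M = prod_list (diag_mat M)"
      by (rule det_lower_triangular[OF _ M]) (auto simp: M_def)
    also have "\<dots> = 1" using M
      by (simp add: prod_list_diag_prod) (auto simp: M_def intro!: prod.neutral)
    finally show ?thesis .
  qed
  ultimately have "det A = det W" using det_mult[OF M W] by simp
  then have "(det A)\<^sup>2 = det (W * W\<^sup>T)"
    using W by (simp add: det_mult[OF W] det_transpose power2_eq_square)
  also have "\<dots> = (\<Prod>i<n. dotp n (?w i) (?w i))"
  proof -
    have entry: "(W * W\<^sup>T) $$ (i, l) = dotp n (?w i) (?w l)" if "i < n" "l < n" for i l
      using that W by (auto simp: times_mat_def scalar_prod_def atLeast0LessThan dotp_def W_def
          intro!: sum.cong)
    have C: "W * W\<^sup>T \<in> carrier_mat n n" using W by auto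
    have "det (W * W\<^sup>T) = prod_list (diag_mat (W * W\<^sup>T))"
      by (rule det_lower_triangular[OF _ C]) (simp add: entry gso_orthogonal)
    also have "\<dots> = (\<Prod>i<n. dotp n (?w i) (?w i))"
      using W by (auto simp: prod_list_diag_prod atLeast0LessThan entry[symmetric]
          intro!: prod.cong)
    finally show ?thesis .
  qed
  also have "\<dots> \<le> (\<Prod>i<n. dotp n (a i) (a i))"
    by (intro prod_mono) (auto simp: dotp_self_nonneg dotp_gso_le)
  also have "\<dots> = (\<Prod>i<n. \<Sum>j<n. (A $$ (i, j))\<^sup>2)"
    by (simp add: dotp_def a_def power2_eq_square)
  finally show ?thesis .
qed

section \<open>Determinants of matrices with grouped rows\<close>

text \<open>For \<open>t > 0\<close> this is \<open>t\<^bsup>m-1\<^esup> (t + m)\<close>, the determinant of the \<open>m \<times> m\<close> matrix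
  \<open>t I + J\<close> with \<open>J\<close> the all-ones matrix. The form chosen avoids the exponent \<open>m - 1\<close>.\<close>

definition group_bound :: "real \<Rightarrow> nat \<Rightarrow> real" where
  "group_bound t m = t ^ m * (1 + real m / t)"

definition preds :: "nat set \<Rightarrow> nat \<Rightarrow> nat set" where
  "preds G i = {l \<in> G. l < i}"

text \<open>The \<open>p\<close>-th pivot (counted from 0) of Gaussian elimination on \<open>t I + J\<close>: the Schur complement
  \<open>t + 1 - p / (t + p)\<close> of the leading \<open>p \<times> p\<close> block.\<close>

definition pivot :: "real \<Rightarrow> nat \<Rightarrow> real" where
  "pivot t p = t * (t + real p + 1) / (t + real p)"

lemma pivot_pos: "t > 0 \<Longrightarrow> pivot t p > 0"
  unfolding pivot_def by (simp add: add_pos_nonneg)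

lemma preds_insert_Max:
  assumes "\<forall>l\<in>G. l < b"
  shows "preds (insert b G) b = G"
    and "i \<in> G \<Longrightarrow> preds (insert b G) i = preds G i"
  using assms by (auto simp: preds_def)

text \<open>The leading minors of \<open>t I + J\<close> are the products of its pivots; the product telescopes.\<close>

lemma prod_pivot:
  assumes "finite G" "t > 0"
  shows "(\<Prod>i\<in>G. pivot t (card (preds G i))) = group_bound t (card G)"
  unfolding group_bound_def using assms(1)
proof (induction rule: finite_linorder_max_induct)
  case empty
  then show ?case by simp
next
  case (insert b G)
  have "b \<notin> G" using insert by auto
  then have "(\<Prod>i\<in>insert b G. pivot t (card (preds (insert b G) i)))
      = pivot t (card G) * (\<Prod>i\<in>G. pivot t (card (preds G i)))"
    using insert by (simp add: preds_insert_Max)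
  also have "\<dots> = pivot t (card G) * (t ^ card G * (1 + real (card G) / t))"
    by (simp only: insert.IH)
  also have "\<dots> = t ^ Suc (card G) * (1 + real (Suc (card G)) / t)"
  proof -
    define q where "q = t + real (card G)"
    have "q > 0" using assms(2) by (simp add: q_def)
    have "1 + real (card G) / t = q / t" "1 + real (Suc (card G)) / t = (q + 1) / t"
      using assms(2) by (simp_all add: q_def field_simps)
    then show ?thesis using \<open>q > 0\<close> assms(2) by (simp add: pivot_def q_def[symmetric])
  qed
  finally show ?case using insert \<open>b \<notin> G\<close> by simp
qed

text \<open>With \<open>Q = t I + J\<close> and \<open>Q = L D L\<^sup>T\<close> its factorisation into a unit lower triangular and a
  diagonal matrix, the left side is \<open>(L\<^bsup>-1\<^esup> x)\<^sup>T D\<^bsup>-1\<^esup> (L\<^bsup>-1\<^esup> x)\<close> and the right side is \<open>x\<^sup>T Q\<^bsup>-1\<^esup> x\<close>, with \<open>Q\<^bsup>-1\<^esup>\<close>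
  written out as \<open>(I - J / (t + m)) / t\<close>. Applied to one column of a matrix at a time.\<close>

lemma sum_reduced_squares:
  fixes x :: "nat \<Rightarrow> real"
  assumes "finite G" "t > 0"
  shows "(\<Sum>i\<in>G. (x i - (\<Sum>l\<in>preds G i. x l) / (t + real (card (preds G i))))\<^sup>2 / pivot t (card (preds G i)))
       = ((\<Sum>i\<in>G. (x i)\<^sup>2) - (\<Sum>i\<in>G. x i)\<^sup>2 / (t + real (card G))) / t"
  using assms(1)
proof (induction rule: finite_linorder_max_induct)
  case empty
  then show ?case by simp
next
  case (insert b G)
  have b: "b \<notin> G" using insert by auto
  define s where "s = (\<Sum>i\<in>G. x i)"
  define Q where "Q = (\<Sum>i\<in>G. (x i)\<^sup>2)"
  define q where "q = t + real (card G)"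
  have q: "q > 0" "q + 1 > 0" using assms(2) by (simp_all add: q_def)
  have "(\<Sum>i\<in>insert b G. (x i - (\<Sum>l\<in>preds (insert b G) i. x l) / (t + real (card (preds (insert b G) i))))\<^sup>2 / pivot t (card (preds (insert b G) i)))
     = (x b - s / q)\<^sup>2 / (t * (q + 1) / q) + (Q - s\<^sup>2 / q) / t"
    using insert b by (simp add: preds_insert_Max s_def Q_def q_def pivot_def)
  also have "\<dots> = (x b ^ 2 + Q - (x b + s)\<^sup>2 / (q + 1)) / t"
    using q assms(2) by (simp add: divide_simps) (simp add: power2_eq_square algebra_simps)
  finally show ?case
    using insert b by (simp add: s_def Q_def q_def ac_simps)
qed

text \<open>Let \<open>Q\<close> be block diagonal with a block \<open>t I + J\<close> for each group, and \<open>L\<close>, \<open>D\<close> its triangular and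
  diagonal factors. The hypothesis says that the block of the Gram matrix \<open>A A\<^sup>T\<close> at \<open>G\<close> has trace
  at most \<open>card G\<close> against \<open>Q\<^bsup>-1\<^esup>\<close>. So the squared lengths of the rows of \<open>L\<^bsup>-1\<^esup> A\<close>,
  weighted by \<open>D\<^bsup>-1\<^esup>\<close>, add up to at most \<open>n\<close>, and
  Hadamard's inequality together with \<open>x \<le> exp (x - 1)\<close> bounds the determinant of \<open>A A\<^sup>T\<close> by that
  of \<open>Q\<close>. Since \<open>L\<close> is unit triangular in the order of the row indices, whatever
  the partition, the rows need not be rearranged to bring groups together.\<close>

theorem det_sq_le_prod_group_bound:
  fixes A :: "real mat" and t :: real
  assumes A: "A \<in> carrier_mat n n" and t: "t > 0" and P: "partition_on {..<n} P"
    and block: "\<And>G. G \<in> P \<Longrightarrow> (\<Sum>j<n. \<Sum>i\<in>G. (A $$ (i, j))\<^sup>2)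
        \<le> t * card G + (\<Sum>j<n. (\<Sum>i\<in>G. A $$ (i, j))\<^sup>2) / (t + card G)"
  shows "(det A)\<^sup>2 \<le> (\<Prod>G\<in>P. group_bound t (card G))"
proof -
  have fin: "finite G" if "G \<in> P" for G
    using partition_onD1[OF P] that by (metis Sup_upper finite_lessThan finite_subset)
  \<comment> \<open>\<open>B i\<close> is the set of rows subtracted from row \<open>i\<close>: those before it in its group.\<close>
  define B where "B i = {l. l < i \<and> (\<exists>G\<in>P. i \<in> G \<and> l \<in> G)}" for i
  have B: "B i = preds G i" if "i \<in> G" "G \<in> P" for i G
    using that partition_onD2[OF P] unfolding B_def disjoint_def preds_def by auto
  have Bi: "B i \<subseteq> {..<i}" for i by (auto simp: B_def)
  define q where "q i = t + real (card (B i))" for i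
  \<comment> \<open>\<open>T\<close> is the inverse of the unit lower triangular factor of \<open>Q\<close>.\<close>
  define T where "T = mat n n (\<lambda>(i, l). if l = i then 1 else if l \<in> B i then - (1 / q i) else 0)"
  have T: "T \<in> carrier_mat n n" unfolding T_def by simp
  have "det T = 1"
  proof -
    have "det T = prod_list (diag_mat T)"
      by (rule det_lower_triangular[OF _ T]) (auto simp: T_def B_def)
    also have "\<dots> = 1" using T
      by (simp add: prod_list_diag_prod) (auto simp: T_def intro!: prod.neutral)
    finally show ?thesis .
  qed
  then have "det A = det (T * A)" using det_mult[OF T A] by simp
  define y where "y i j = A $$ (i, j) - (\<Sum>l\<in>B i. A $$ (l, j)) / q i" for i j
  have TA: "(T * A) $$ (i, j) = y i j" if i: "i < n" and j: "j < n" for i j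
  proof -
    have "(T * A) $$ (i, j) = (\<Sum>l<n. T $$ (i, l) * A $$ (l, j))"
      using i j T A by (auto simp: times_mat_def scalar_prod_def atLeast0LessThan intro!: sum.cong)
    also have "\<dots> = (\<Sum>l<n. (if l = i then A $$ (i, j) else 0)
                           + (if l \<in> B i then - (1 / q i) * A $$ (l, j) else 0))"
      using i j by (intro sum.cong) (auto simp: T_def B_def)
    also have "\<dots> = A $$ (i, j) + (\<Sum>l\<in>{..<n} \<inter> B i. - (1 / q i) * A $$ (l, j))"
      using i by (simp only: sum.distrib sum.inter_restrict[OF finite_lessThan]) simp
    also have "{..<n} \<inter> B i = B i" using Bi[of i] i by auto
    finally show ?thesis by (simp add: y_def sum_divide_distrib sum_negf)
  qed
  define d where "d i = pivot t (card (B i))" for i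
  have d: "d i > 0" for i unfolding d_def by (rule pivot_pos[OF t])
  define z where "z i = (\<Sum>j<n. (y i j)\<^sup>2) / d i" for i
  have z: "z i \<ge> 0" for i using d[of i] unfolding z_def by (intro divide_nonneg_pos sum_nonneg) auto
  have UP: "{..<n} = \<Union>P" using partition_onD1[OF P] by simp
  have disj: "\<forall>G\<in>P. \<forall>H\<in>P. G \<noteq> H \<longrightarrow> G \<inter> H = {}"
    using partition_onD2[OF P] unfolding disjoint_def by auto
  have "(\<Sum>i<n. z i) \<le> real n"
  proof -
    have "(\<Sum>i\<in>G. z i) \<le> real (card G)" if G: "G \<in> P" for G
    proof -
      have "(\<Sum>i\<in>G. z i) = (\<Sum>j<n. \<Sum>i\<in>G. (y i j)\<^sup>2 / d i)"
        unfolding z_def sum_divide_distrib by (rule sum.swap)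
      also have "\<dots> = (\<Sum>j<n. ((\<Sum>i\<in>G. (A $$ (i, j))\<^sup>2) - (\<Sum>i\<in>G. A $$ (i, j))\<^sup>2 / (t + real (card G))) / t)"
        by (rule sum.cong[OF refl], subst sum_reduced_squares[OF fin[OF G] t, symmetric])
           (use G in \<open>auto simp: y_def d_def q_def B intro!: sum.cong\<close>)
      also have "\<dots> = ((\<Sum>j<n. \<Sum>i\<in>G. (A $$ (i, j))\<^sup>2)
           - (\<Sum>j<n. (\<Sum>i\<in>G. A $$ (i, j))\<^sup>2) / (t + card G)) / t"
        by (simp add: sum_divide_distrib[symmetric] sum_subtractf)
      also have "\<dots> \<le> (t * card G) / t"
        using block[OF G] t by (intro divide_right_mono) auto
      finally show ?thesis using t by simp
    qed
    then have "(\<Sum>G\<in>P. \<Sum>i\<in>G. z i) \<le> (\<Sum>G\<in>P. real (card G))"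
      by (rule sum_mono)
    also have "\<dots> = (\<Sum>G\<in>P. \<Sum>i\<in>G. 1)" by simp
    also have "\<dots> = (\<Sum>i<n. 1)"
      unfolding UP using sum.Union_disjoint[of P "\<lambda>_. 1 :: real"] fin disj by simp
    also have "(\<Sum>G\<in>P. \<Sum>i\<in>G. z i) = (\<Sum>i<n. z i)"
      unfolding UP using sum.Union_disjoint[of P z] fin disj by simp
    finally show ?thesis by simp
  qed
  have "(\<Prod>i<n. z i) \<le> (\<Prod>i<n. exp (z i - 1))"
    using z exp_ge_add_one_self[of "z _ - 1"] by (intro prod_mono) auto
  also have "\<dots> = exp (\<Sum>i<n. z i - 1)" by (simp add: exp_sum)
  also have "\<dots> \<le> 1" using \<open>(\<Sum>i<n. z i) \<le> real n\<close> by (simp add: sum_subtractf)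
  finally have z1: "(\<Prod>i<n. z i) \<le> 1" .
  have "(det A)\<^sup>2 \<le> (\<Prod>i<n. \<Sum>j<n. ((T * A) $$ (i, j))\<^sup>2)"
    unfolding \<open>det A = det (T * A)\<close> using T A by (intro hadamard_inequality) auto
  also have "\<dots> = (\<Prod>i<n. z i * d i)"
    using d by (intro prod.cong refl) (auto simp: TA z_def less_imp_neq[symmetric])
  also have "\<dots> = (\<Prod>i<n. z i) * (\<Prod>i<n. d i)" by (rule prod.distrib)
  also have "\<dots> \<le> (\<Prod>i<n. d i)"
    using z1 d by (intro mult_left_le_one_le) (auto simp: z less_imp_le prod_nonneg)
  also have "\<dots> = (\<Prod>G\<in>P. \<Prod>i\<in>G. d i)"
    unfolding UP using prod.Union_disjoint[of P d] fin disj by simp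
  also have "\<dots> = (\<Prod>G\<in>P. \<Prod>i\<in>G. pivot t (card (preds G i)))"
    by (intro prod.cong refl) (simp add: d_def B)
  also have "\<dots> = (\<Prod>G\<in>P. group_bound t (card G))"
    using fin t by (intro prod.cong refl) (simp add: prod_pivot)
  finally show ?thesis .
qed

text \<open>The column sums \<open>s\<^sub>j\<close> over the group are natural numbers, so \<open>s\<^sub>j \<le> s\<^sub>j\<^sup>2\<close>, while the common
  column contributes \<open>m\<^sup>2\<close> instead of only \<open>m = card G\<close>. As the column sums add up to \<open>(t + 1) m\<close>,
  their squares add up to at least \<open>m (t + m)\<close>, exactly what is needed to turn \<open>(t + 1) m\<close>
  into \<open>t m\<close>.\<close>

lemma sum_squares_le_of_common_column:
  fixes a :: "'i \<Rightarrow> nat \<Rightarrow> real" and t :: real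
  assumes G: "finite G" and t: "t + card G > 0"
    and a01: "\<And>i j. i \<in> G \<Longrightarrow> j < n \<Longrightarrow> a i j \<in> {0, 1}"
    and rows: "\<And>i. i \<in> G \<Longrightarrow> (\<Sum>j<n. a i j) = t + 1"
    and v: "v < n" "\<And>i. i \<in> G \<Longrightarrow> a i v = 1"
  shows "(\<Sum>j<n. \<Sum>i\<in>G. (a i j)\<^sup>2) \<le> t * card G + (\<Sum>j<n. (\<Sum>i\<in>G. a i j)\<^sup>2) / (t + card G)"
proof -
  define s where "s j = (\<Sum>i\<in>G. a i j)" for j
  have sq: "(a i j)\<^sup>2 = a i j" if "i \<in> G" "j < n" for i j using a01[OF that] by auto
  have "(\<Sum>j<n. \<Sum>i\<in>G. (a i j)\<^sup>2) = (\<Sum>j<n. s j)" unfolding s_def by (simp add: sq)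
  also have sum_s: "(\<Sum>j<n. s j) = (t + 1) * card G"
    unfolding s_def by (subst sum.swap) (simp add: rows)
  finally have tot: "(\<Sum>j<n. \<Sum>i\<in>G. (a i j)\<^sup>2) = (t + 1) * card G" .
  have sj: "s j \<le> (s j)\<^sup>2" if "j < n" for j
  proof -
    have "s j = of_nat (card {i\<in>G. a i j = 1})"
    proof -
      have "s j = (\<Sum>i\<in>G. if a i j = 1 then 1 else 0)"
        unfolding s_def using a01[OF _ that] by (intro sum.cong) auto
      then show ?thesis using G by (simp add: sum.If_cases Int_def)
    qed
    then obtain m :: nat where "s j = real m" by blast
    moreover have "m \<le> m\<^sup>2" by (simp add: power2_eq_square)
    ultimately show ?thesis by (metis of_nat_le_iff of_nat_power)
  qed
  have sv: "s v = card G" unfolding s_def using v by simp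
  \<comment> \<open>The square of \<open>s v = card G\<close> is kept; every other square is bounded below by the sum itself.\<close>
  have "(t + card G) * card G = (card G)\<^sup>2 + ((\<Sum>j<n. s j) - s v)"
    by (simp add: sum_s sv algebra_simps power2_eq_square)
  also have "\<dots> = (s v)\<^sup>2 + (\<Sum>j\<in>{..<n} - {v}. s j)"
    using v by (simp add: sum_diff1 sv)
  also have "\<dots> \<le> (s v)\<^sup>2 + (\<Sum>j\<in>{..<n} - {v}. (s j)\<^sup>2)"
    by (intro add_left_mono sum_mono sj) auto
  also have "\<dots> = (\<Sum>j<n. (s j)\<^sup>2)"
    using v by (simp add: sum.remove[of "{..<n}" v])
  finally have "card G \<le> (\<Sum>j<n. (s j)\<^sup>2) / (t + card G)"
    using t by (simp add: pos_le_divide_eq mult.commute)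
  then show ?thesis unfolding tot s_def by (simp add: algebra_simps)
qed

section \<open>A greedy partition into groups with a common column\<close>

text \<open>The average number of sets \<open>E i\<close> through a point of \<open>V\<close> is \<open>k * card S / card V\<close>.\<close>

lemma exists_high_degree:
  assumes "finite S" "finite V" and E: "\<forall>i\<in>S. E i \<subseteq> V \<and> card (E i) = k"
    and gt: "k * card S > j * card V"
  shows "\<exists>v\<in>V. j < card {i\<in>S. v \<in> E i}"
proof (rule ccontr)
  assume "\<not> ?thesis"
  then have "(\<Sum>v\<in>V. card {i\<in>S. v \<in> E i}) \<le> (\<Sum>v\<in>V. j)"
    by (intro sum_mono) (auto simp: not_less)
  moreover have "(\<Sum>v\<in>V. card {i\<in>S. v \<in> E i}) = (\<Sum>i\<in>S. card {v\<in>V. v \<in> E i})"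
    by (rule sum_multicount_gen[OF assms(2,1)]) (simp add: assms)
  moreover have "(\<Sum>i\<in>S. card {v\<in>V. v \<in> E i}) = (\<Sum>i\<in>S. k)"
    using E by (intro sum.cong refl) (metis Collect_mem_eq Int_def inf.absorb2)
  ultimately show False using gt by (simp add: mult.commute)
qed

text \<open>A family of sets \<open>E i\<close> with \<open>i \<in> S\<close> is split into subfamilies each with a common point.
  For a matrix, \<open>E i\<close> is the set of columns in which row \<open>i\<close> has a one.\<close>

definition grouping :: "('a \<Rightarrow> 'b set) \<Rightarrow> 'a set \<Rightarrow> 'a set set \<Rightarrow> bool" where
  "grouping E S P \<longleftrightarrow> partition_on S P \<and> (\<forall>G\<in>P. \<exists>v. \<forall>i\<in>G. v \<in> E i)"

lemma grouping_insert:
  assumes P: "grouping E (S - G) P" and "G \<subseteq> S" "G \<noteq> {}" "finite S" "\<forall>i\<in>G. v \<in> E i"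
  shows "grouping E S (insert G P)"
    and "(\<Prod>H\<in>insert G P. c (card H)) = (c (card G) :: real) * (\<Prod>H\<in>P. c (card H))"
proof -
  have part: "partition_on (S - G) P" using P by (simp add: grouping_def)
  then have "\<Union>P = S - G" by (simp add: partition_on_def)
  then have "G \<inter> \<Union>P = {}" by auto
  then have "partition_on S (insert G P)"
    using part assms by (subst partition_on_insert) (auto simp: disjnt_def)
  then show "grouping E S (insert G P)" using P assms by (auto simp: grouping_def)
  have "G \<notin> P" using \<open>G \<inter> \<Union>P = {}\<close> assms by auto
  moreover have "finite P" using part assms(4) by (meson finite_Diff finite_elements)
  ultimately show "(\<Prod>H\<in>insert G P. c (card H)) = c (card G) * (\<Prod>H\<in>P. c (card H))" by simp
qed

text \<open>As long as more than \<open>(j - 1) n / k\<close> of the sets are left, where \<open>n = card V\<close>, some point lies in \<open>j\<close> of them, and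
  these \<open>j\<close> form a group. Going from \<open>j n / k\<close> sets down to \<open>(j - 1) n / k\<close> thus takes at most \<open>n / (k j) + 1\<close>
  groups of size \<open>j\<close>; the extra 1 is the rounding loss. As \<open>c j \<ge> 1\<close>, counting more groups than
  are used only increases the bound.\<close>

theorem greedy_grouping:
  fixes E :: "'a \<Rightarrow> 'b set" and c :: "nat \<Rightarrow> real"
  assumes V: "finite V" and k: "k > 0"
    and c: "\<And>j. c j \<ge> 1"
  assumes S: "finite S" "\<forall>i\<in>S. E i \<subseteq> V \<and> card (E i) = k"
    and "k * card S \<le> j * card V"
  shows "\<exists>P. grouping E S P \<and>
           (\<Prod>G\<in>P. c (card G)) \<le> (\<Prod>i=1..j. c i powr (real (card V) / (real k * real i) + 1))"
  using S assms(6)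
proof (induction j arbitrary: S)
  case 0
  then have "S = {}" using k by simp
  then show ?case by (intro exI[of _ "{}"]) (auto simp: grouping_def partition_on_empty)
next
  case (Suc j)
  let ?n = "card V"
  define b where "b = (\<Prod>i=1..j. c i powr (real ?n / (real k * real i) + 1))"
  define e where "e = c (Suc j)"
  have c_pos: "c i > 0" for i using c[of i] by linarith
  have b: "b > 0" unfolding b_def using c_pos
    by (intro prod_pos ballI) (simp add: less_imp_neq[THEN not_sym])
  have e: "e \<ge> 1" "e > 0" using c[of "Suc j"] by (auto simp: e_def)
  have lower: "\<exists>P. grouping E S P \<and> (\<Prod>G\<in>P. c (card G)) \<le> b"
    if "k * card S \<le> j * ?n" "finite S" "\<forall>i\<in>S. E i \<subseteq> V \<and> card (E i) = k" for S
    unfolding b_def using Suc.IH[OF that(2,3,1)] .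
  have inner: "\<exists>P. grouping E S P \<and>
      (\<Prod>G\<in>P. c (card G)) \<le> b * e powr ((k * card S - j * real ?n) / (real k * real (Suc j)) + 1)"
    if "k * card S > j * ?n" "finite S" "\<forall>i\<in>S. E i \<subseteq> V \<and> card (E i) = k" for S
    using that
  proof (induction "card S" arbitrary: S rule: less_induct)
    case less
    obtain v where v: "v \<in> V" "Suc j \<le> card {i\<in>S. v \<in> E i}"
      using exists_high_degree[OF less.prems(2) V less.prems(3,1)] by (auto simp: Suc_le_eq)
    obtain G where G: "G \<subseteq> {i\<in>S. v \<in> E i}" "card G = Suc j" "finite G"
      using obtain_subset_with_card_n[OF v(2)] by blast
    have GS: "G \<subseteq> S" "G \<noteq> {}" "\<forall>i\<in>G. v \<in> E i" using G by auto
    have cardS: "card (S - G) = card S - Suc j" "Suc j \<le> card S"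
      using card_Diff_subset[OF G(3) GS(1)] card_mono[OF less.prems(2) GS(1)] G(2) by simp_all
    have sub: "\<forall>i\<in>S - G. E i \<subseteq> V \<and> card (E i) = k" using less.prems(3) by blast
    define x where "x = (k * card S - j * real ?n) / (real k * real (Suc j))"
    have "real (j * ?n) < real (k * card S)" using less.prems(1) by (simp only: of_nat_less_iff)
    then have x: "x > 0"
      unfolding x_def using k by (intro divide_pos_pos) (simp_all del: of_nat_Suc)
    \<comment> \<open>Taking out \<open>G\<close> lowers \<open>x\<close> by 1. If that passes the threshold, the last group is paid
      for by the extra 1 in the exponent.\<close>
    have "\<exists>P. grouping E (S - G) P \<and> e * (\<Prod>H\<in>P. c (card H)) \<le> b * e powr (x + 1)"
    proof (cases "k * card (S - G) \<le> j * ?n")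
      case True
      obtain P where P: "grouping E (S - G) P" "(\<Prod>H\<in>P. c (card H)) \<le> b"
        using lower[OF True finite_Diff[OF less.prems(2)] sub] by blast
      have "e * (\<Prod>H\<in>P. c (card H)) \<le> e * b" using P e by simp
      also have "e powr 1 \<le> e powr (x + 1)" using e x by (intro powr_mono) auto
      then have "e * b \<le> b * e powr (x + 1)" using b e by simp
      finally show ?thesis using P by blast
    next
      case False
      obtain P where P: "grouping E (S - G) P"
        "(\<Prod>H\<in>P. c (card H)) \<le> b * e powr ((k * card (S - G) - j * real ?n) / (real k * real (Suc j)) + 1)"
        using less.hyps[OF _ _ finite_Diff[OF less.prems(2)] sub] False cardS
        unfolding not_le by (metis diff_less less_le_trans zero_less_Suc)
      have "real (k * card (S - G)) = real k * real (card S) - real k * real (Suc j)"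
        using cardS by (simp add: of_nat_diff right_diff_distrib)
      moreover have "real k * real (Suc j) \<noteq> 0" using k by simp
      ultimately have "(k * card (S - G) - j * real ?n) / (real k * real (Suc j)) + 1 = x"
        unfolding x_def by (simp add: diff_divide_distrib del: of_nat_Suc)
      then have "e * (\<Prod>H\<in>P. c (card H)) \<le> e * (b * e powr x)" using P e by simp
      also have "\<dots> = b * e powr (x + 1)" using e by (simp add: powr_add)
      finally show ?thesis using P by blast
    qed
    then obtain P where P: "grouping E (S - G) P" "e * (\<Prod>H\<in>P. c (card H)) \<le> b * e powr (x + 1)"
      by blast
    note ins = grouping_insert[OF P(1) GS(1,2) less.prems(2) GS(3)]
    have "(\<Prod>H\<in>insert G P. c (card H)) \<le> b * e powr (x + 1)"
      using P(2) ins(2)[of c] G(2) by (simp add: e_def)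
    then show ?case using ins(1) unfolding x_def by blast
  qed
  define y where "y = real ?n / (real k * real (Suc j))"
  have y: "y \<ge> 0" by (simp add: y_def)
  have goal: "(\<Prod>i=1..Suc j. c i powr (real ?n / (real k * real i) + 1)) = b * e powr (y + 1)"
    by (simp add: b_def e_def y_def)
  show ?case
  proof (cases "k * card S \<le> j * ?n")
    case True
    have "e powr 0 \<le> e powr (y + 1)" using e y by (intro powr_mono) auto
    then have "b * 1 \<le> b * e powr (y + 1)" using b e by (intro mult_left_mono) auto
    then show ?thesis
      using lower[OF True Suc.prems(1,2)] unfolding goal mult_1_right by (meson order_trans)
  next
    case False
    have "real (k * card S) \<le> real (Suc j * ?n)" using Suc.prems(3) by (simp only: of_nat_le_iff)
    then have "(k * card S - j * real ?n) / (real k * real (Suc j)) \<le> y"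
      unfolding y_def by (intro divide_right_mono) (simp_all add: algebra_simps)
    then have "b * e powr ((k * card S - j * real ?n) / (real k * real (Suc j)) + 1) \<le> b * e powr (y + 1)"
      using b e by (intro mult_left_mono powr_mono) auto
    then show ?thesis
      using inner[OF _ Suc.prems(1,2)] False unfolding goal not_le by (meson order_trans)
  qed
qed

section \<open>Comparison with the closed form\<close>

text \<open>Jensen's inequality for \<open>ln\<close> with weights \<open>1 / i\<close>: the total weight is \<open>harm k\<close> and the weighted
  mean of \<open>t + i\<close> is \<open>m = t + k / harm k\<close>. The proof uses the tangent of \<open>ln\<close> at \<open>m\<close>.\<close>

lemma sum_harmonic_ln_le:
  fixes t :: real
  assumes "t > 0" "k > 0"
  shows "(\<Sum>i=1..k. ln (t + real i) / real i) \<le> harm k * ln (t + real k / harm k)"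
proof -
  define H :: real where "H = harm k"
  have H: "H > 0" unfolding H_def using assms(2) by (rule harm_pos)
  have H_sum: "H = (\<Sum>i=1..k. 1 / real i)" by (simp add: H_def harm_def inverse_eq_divide)
  define m where "m = t + real k / H"
  have m: "m > 0" using assms H by (simp add: m_def add_pos_nonneg)
  have "(\<Sum>i=1..k. ln (t + real i) / real i) \<le> (\<Sum>i=1..k. (ln m + (t + real i) / m - 1) / real i)"
  proof (intro sum_mono divide_right_mono)
    fix i
    have p: "t + real i > 0" using assms by simp
    then have "ln ((t + real i) / m) \<le> (t + real i) / m - 1"
      using m by (intro ln_le_minus_one) simp
    then show "ln (t + real i) \<le> ln m + (t + real i) / m - 1"
      using m p by (simp add: ln_div)
  qed simp
  also have "\<dots> = (\<Sum>i=1..k. (ln m + t / m - 1) * (1 / real i) + 1 / m)"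
    using m by (intro sum.cong) (auto simp: field_simps)
  also have "\<dots> = (ln m + t / m - 1) * H + real k / m"
    by (simp add: sum.distrib H_sum sum_distrib_left)
  also have "\<dots> = H * ln m + ((t * H + real k) / m - H)"
    by (simp add: algebra_simps add_divide_distrib)
  also have "t * H + real k = H * m"
    using H by (simp add: m_def field_simps)
  also have "H * ln m + (H * m / m - H) = H * ln m" using m by simp
  finally show ?thesis by (simp add: m_def H_def)
qed

lemma prod_shifted_eq_fact_quotient:
  "(\<Prod>i=1..m. real (a + i)) = fact (a + m) / fact a"
  by (induction m) auto

lemma sum_diff_one: "(\<Sum>i=1..k. real i - 1) = ((real k)\<^sup>2 - real k) / 2"
  by (induction k) (auto simp: power2_eq_square field_simps)

lemma group_bound_ge_1:
  assumes "t \<ge> 1"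
  shows "group_bound t m \<ge> 1"
proof -
  have "1 * 1 \<le> t ^ m * (1 + real m / t)"
    using assms by (intro mult_mono one_le_power) auto
  then show ?thesis by (simp add: group_bound_def)
qed

lemma ln_group_bound:
  assumes "t \<ge> 1"
  shows "ln (group_bound t m) = (real m - 1) * ln t + ln (t + real m)"
proof -
  have "t + real m > 0" using assms by simp
  have "group_bound t m = t ^ m * (t + real m) / t"
    using assms by (simp add: group_bound_def field_simps)
  then have "ln (group_bound t m) = real m * ln t + ln (t + real m) - ln t"
    using assms \<open>t + real m > 0\<close> by (simp only:) (simp add: ln_mult ln_div ln_realpow)
  then show ?thesis by (simp add: algebra_simps)
qed

text \<open>The factor \<open>alpha k\<close> is the rounding loss: one additional group of each size from 1 to \<open>k\<close>.\<close>

lemma alpha_sq: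
  assumes "k \<ge> 2"
  shows "(alpha k)\<^sup>2 = (\<Prod>i=1..k. group_bound (real k - 1) i)"
proof -
  define t where "t = real k - 1"
  have t: "t \<ge> 1" "t > 0" using assms by (simp_all add: t_def)
  have "(\<Prod>i=1..k. group_bound t i) = (\<Prod>i=1..k. exp ((real i - 1) * ln t) * real (k - 1 + i))"
  proof (intro prod.cong refl)
    fix i
    have "group_bound t i = exp (ln (group_bound t i))"
      using group_bound_ge_1[OF t(1), of i] by simp
    also have "\<dots> = exp ((real i - 1) * ln t) * real (k - 1 + i)"
      using t assms by (simp add: ln_group_bound exp_add t_def of_nat_diff add_pos_nonneg)
    finally show "group_bound t i = exp ((real i - 1) * ln t) * real (k - 1 + i)" .
  qed
  also have "\<dots> = exp ((\<Sum>i=1..k. real i - 1) * ln t) * (\<Prod>i=1..k. real (k - 1 + i))"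
    by (simp only: prod.distrib sum_distrib_right exp_sum[OF finite_atLeastAtMost])
  also have "\<dots> = exp (((real k)\<^sup>2 - real k) / 2 * ln t) * (fact (2 * k - 1) / fact (k - 1))"
  proof -
    have "k - 1 + k = 2 * k - 1" using assms by simp
    then show ?thesis by (simp only: sum_diff_one prod_shifted_eq_fact_quotient)
  qed
  also have "exp (((real k)\<^sup>2 - real k) / 2 * ln t) = (rpow t (1 / 4 * ((real k)\<^sup>2 - real k)))\<^sup>2"
    using t by (simp add: rpow_def powr_def exp_double[symmetric])
  finally show ?thesis
    by (simp add: alpha_def t_def power_mult_distrib mult.commute)
qed

text \<open>In the exponent, \<open>ln t\<close> has the coefficient \<open>n / k * (\<Sum>i=1..k. (i - 1) / i) = n / k * (k - harm k)\<close>,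
  and the terms \<open>ln (t + i)\<close> are combined by Jensen's inequality, where \<open>t = k - 1\<close>.\<close>

lemma prod_group_bound_le_beta:
  assumes "k \<ge> 2"
  shows "(\<Prod>i=1..k. group_bound (real k - 1) i powr (real n / (real k * real i))) \<le> (beta k ^ n)\<^sup>2"
proof -
  define t where "t = real k - 1"
  have t: "t \<ge> 1" "t > 0" using assms by (simp_all add: t_def)
  define H :: real where "H = harm k"
  have H: "H > 0" unfolding H_def using assms by (intro harm_pos) simp
  have H_sum: "H = (\<Sum>i=1..k. 1 / real i)" by (simp add: H_def harm_def inverse_eq_divide)
  define m where "m = t + real k / H"
  have m: "m > 0" using t H by (simp add: m_def add_pos_nonneg)
  have "(\<Prod>i=1..k. group_bound t i powr (real n / (real k * real i)))
      = (\<Prod>i=1..k. exp (real n / real k * (ln (group_bound t i) / real i)))"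
    using group_bound_ge_1[OF t(1)]
    by (intro prod.cong refl) (auto simp: powr_def; metis not_one_le_zero)
  also have "\<dots> = exp (real n / real k * (\<Sum>i=1..k. ln (group_bound t i) / real i))"
    by (simp only: sum_distrib_left exp_sum[OF finite_atLeastAtMost])
  also have "(\<Sum>i=1..k. ln (group_bound t i) / real i)
      = (\<Sum>i=1..k. ln t - ln t * (1 / real i) + ln (t + real i) / real i)"
    using t by (intro sum.cong) (auto simp: ln_group_bound field_simps)
  also have "\<dots> = real k * ln t - ln t * H + (\<Sum>i=1..k. ln (t + real i) / real i)"
    by (simp add: sum.distrib sum_subtractf H_sum sum_distrib_left)
  also have "exp (real n / real k * \<dots>)
      \<le> exp (real n / real k * (real k * ln t - ln t * H + H * ln m))"
    using sum_harmonic_ln_le[OF t(2), of k] assms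
    by (intro iffD2[OF exp_le_cancel_iff] mult_left_mono) (auto simp: m_def H_def)
  also have "\<dots> = (exp (1/2 * (H / k) * ln m + 1/2 * (1 - H / k) * ln t) ^ n)\<^sup>2"
    using assms by (simp add: exp_of_nat_mult[symmetric] exp_double[symmetric] field_simps)
  also have "exp (1/2 * (H / k) * ln m + 1/2 * (1 - H / k) * ln t) = beta k"
  proof -
    have "real k + real k / H - 1 = m" by (simp add: m_def t_def)
    then show ?thesis using m t by (simp add: beta_def H_def[symmetric] t_def[symmetric]
          rpow_def powr_def exp_add)
  qed
  finally show ?thesis by (simp add: t_def)
qed

lemma alpha_nonneg: "alpha k \<ge> 0" and beta_nonneg: "beta k \<ge> 0"
  by (auto simp: alpha_def beta_def rpow_def)

lemma det_sq_row_regular_le: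
  assumes A: "A \<in> row_regular_mats n k" and k: "k \<ge> 2"
  shows "(det A)\<^sup>2 \<le> (\<Prod>i=1..k. group_bound (real k - 1) i powr (real n / (real k * real i) + 1))"
proof -
  have dim: "A \<in> carrier_mat n n"
    and A01: "\<And>i j. i < n \<Longrightarrow> j < n \<Longrightarrow> A $$ (i, j) \<in> {0, 1}"
    and rows: "\<And>i. i < n \<Longrightarrow> (\<Sum>j<n. A $$ (i, j)) = real k"
    using A by (auto simp: row_regular_mats_def)
  define t where "t = real k - 1"
  have t: "t \<ge> 1" "t > 0" using k by (simp_all add: t_def)
  define E where "E i = {j. j < n \<and> A $$ (i, j) = 1}" for i
  have E: "E i \<subseteq> {..<n} \<and> card (E i) = k" if "i < n" for i
  proof -
    have "(\<Sum>j<n. A $$ (i, j)) = (\<Sum>j<n. if A $$ (i, j) = 1 then 1 else 0)"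
      using A01[OF that] by (intro sum.cong) auto
    also have "\<dots> = real (card (E i))"
      by (simp add: sum.If_cases E_def Int_def)
    finally show ?thesis using rows[OF that] by (auto simp: E_def)
  qed
  obtain P where P: "grouping E {..<n} P"
    and le: "(\<Prod>G\<in>P. group_bound t (card G))
        \<le> (\<Prod>i=1..k. group_bound t i powr (real n / (real k * real i) + 1))"
    using greedy_grouping[of "{..<n}" k "group_bound t" "{..<n}" E k] k E group_bound_ge_1[OF t(1)]
    by auto
  have part: "partition_on {..<n} P" using P by (simp add: grouping_def)
  have "(det A)\<^sup>2 \<le> (\<Prod>G\<in>P. group_bound t (card G))"
  proof (rule det_sq_le_prod_group_bound[OF dim t(2) part])
    fix G assume G: "G \<in> P"
    have Gn: "G \<subseteq> {..<n}" using part G by (auto simp: partition_on_def)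
    then have fin: "finite G" by (rule finite_subset) simp
    have ne: "G \<noteq> {}" using part G by (auto simp: partition_on_def)
    obtain v where v: "\<forall>i\<in>G. v \<in> E i" using P G unfolding grouping_def by blast
    have "v < n" using ne v by (auto simp: E_def)
    then show "(\<Sum>j<n. \<Sum>i\<in>G. (A $$ (i, j))\<^sup>2)
        \<le> t * card G + (\<Sum>j<n. (\<Sum>i\<in>G. A $$ (i, j))\<^sup>2) / (t + card G)"
      using Gn fin t v A01 rows
      by (intro sum_squares_le_of_common_column[where a = "\<lambda>i j. A $$ (i, j)" and v = v]) (auto simp: E_def t_def)
  qed
  then show ?thesis using le by (simp add: t_def)
qed

text \<open>For \<open>k = 1\<close> the comparison matrix \<open>t I + J\<close> with \<open>t = k - 1\<close> is singular, but Hadamard's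
  inequality alone suffices.\<close>

lemma det_sq_row_regular_1_le:
  assumes A: "A \<in> row_regular_mats n 1"
  shows "(det A)\<^sup>2 \<le> 1"
proof -
  have dim: "A \<in> carrier_mat n n"
    and A01: "\<And>i j. i < n \<Longrightarrow> j < n \<Longrightarrow> A $$ (i, j) \<in> {0, 1}"
    and rows: "\<And>i. i < n \<Longrightarrow> (\<Sum>j<n. A $$ (i, j)) = 1"
    using A by (auto simp: row_regular_mats_def)
  have "(\<Sum>j<n. (A $$ (i, j))\<^sup>2) = 1" if "i < n" for i
  proof -
    have "(\<Sum>j<n. (A $$ (i, j))\<^sup>2) = (\<Sum>j<n. A $$ (i, j))"
      using A01[OF that] by (intro sum.cong) fastforce+
    then show ?thesis using rows[OF that] by simp
  qed
  then show ?thesis using hadamard_inequality[OF dim] by simp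
qed

theorem theorem5p1:
  fixes n k :: nat
  assumes "0 < n" and "0 < k" and "k \<le> n"
  shows "max_det_row_regular n k \<le> alpha k * beta k ^ n"
proof -
  have "det A \<le> alpha k * beta k ^ n" if A: "A \<in> row_regular_mats n k" for A
  proof (rule power2_le_imp_le)
    show "0 \<le> alpha k * beta k ^ n" by (simp add: alpha_nonneg beta_nonneg)
    show "(det A)\<^sup>2 \<le> (alpha k * beta k ^ n)\<^sup>2"
    proof (cases "k = 1")
      case True
      have "alpha 1 = 1" "beta 1 = 1" by (simp_all add: alpha_def beta_def rpow_def harm_def)
      then show ?thesis using det_sq_row_regular_1_le A True by simp
    next
      case False
      then have k: "k \<ge> 2" using assms by simp
      have "(det A)\<^sup>2 \<le> (\<Prod>i=1..k. group_bound (real k - 1) i powr (real n / (real k * real i) + 1))"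
        using det_sq_row_regular_le[OF A k] .
      also have "\<dots> = (\<Prod>i=1..k. group_bound (real k - 1) i)
          * (\<Prod>i=1..k. group_bound (real k - 1) i powr (real n / (real k * real i)))"
      proof -
        have "group_bound (real k - 1) i > 0" for i
          using group_bound_ge_1[of "real k - 1" i] k by simp
        then show ?thesis
          by (simp add: prod.distrib[symmetric] powr_add less_imp_le mult.commute)
      qed
      also have "\<dots> \<le> (alpha k)\<^sup>2 * (beta k ^ n)\<^sup>2"
        unfolding alpha_sq[OF k, symmetric]
        by (intro mult_left_mono prod_group_bound_le_beta k) simp
      finally show ?thesis by (simp add: power_mult_distrib)
    qed
  qed
  then show ?thesis
    unfolding max_det_row_regular_def
    using finite_row_regular_mats row_regular_mats_nonempty[OF assms(3)]
    by (intro Max.boundedI) auto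
qed

end
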